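(* Let $G$ and $H$ be finitely generated groups with the same two-sided configuration sets, i.e. $\operatorname{Con}_{\mathrm t}(G)=\operatorname{Con}_{\mathrm t}(H)$, and let $n\in\mathbb N$. Then $G$ and $H$ contain exactly the same number of normal subgroups of index $n$. Moreover, $$\prod\{G/N:\ N\trianglelefteq G,\ |G:N|<\infty\}\;\cong\;\prod\{H/\mathfrak N:\ \mathfrak N\trianglelefteq H,\ |H:\mathfrak N|<\infty\}.$$
   Context: A configuration pair $(\mathfrak g,\mathcal E)$ of a finitely generated (discrete) group $G$ consists of an ordered generating set, i.e. a finite tuple $\mathfrak g=(g_1,\dots,g_n)$ of elements of $G$ whose entries generate $G$ as a group, and a finite partition $\mathcal E=\{E_1,\dots,E_m\}$ of $G$ with indexed blocks. A two-sided configuration corresponding to $(\mathfrak g,\mathcal E)$ is a $(2n+1)$-tuple $C=(c_0,c_1,\dots,c_{2n})$ with $c_i\in\{1,\dots,m\}$ for which there exists $x\in E_{c_0}$ such that $g_ix\in E_{c_i}$ and $xg_i\in E_{c_{i+n}}$ for each $i\in\{1,\dots,n\}$. The set of all of these is denoted $\operatorname{Con}_{\mathrm t}(\mathfrak g,\mathcal E)$. $\operatorname{Con}_{\mathrm t}(G)$ is the set of all sets $\operatorname{Con}_{\mathrm t}(\mathfrak g,\mathcal E)$, where $(\mathfrak g,\mathcal E)$ ranges over all configuration pairs of $G$. The products are direct products of groups, with one factor for each normal subgroup of finite index. *)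

theory Defs
  imports "HOL-Algebra.Algebra" "HOL-Library.Disjoint_Sets" "HOL-Library.Equipollence"
begin

definition generating_tuple :: "('a, 'c) monoid_scheme \<Rightarrow> 'a list \<Rightarrow> bool" where
  "generating_tuple G gs \<longleftrightarrow> set gs \<subseteq> carrier G \<and> generate G (set gs) = carrier G"

definition finitely_generated_group :: "('a, 'c) monoid_scheme \<Rightarrow> bool" where
  "finitely_generated_group G \<longleftrightarrow>
     group G \<and> (\<exists>S. finite S \<and> S \<subseteq> carrier G \<and> generate G S = carrier G)"

text \<open>A finite partition with indexed blocks is a list of pairwise distinct blocks.\<close>

definition configuration_pair :: "('a, 'c) monoid_scheme \<Rightarrow> 'a list \<Rightarrow> 'a set list \<Rightarrow> bool" where
  "configuration_pair G gs Es \<longleftrightarrow>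
     generating_tuple G gs \<and> distinct Es \<and> partition_on (carrier G) (set Es)"

text \<open>
  Lists are indexed from 0: for a generating tuple of length \<open>n\<close>, its \<open>i\<close>-th entry is
  \<open>gs ! (i - 1)\<close>, whereas the configuration \<open>C\<close> has entries \<open>C ! 0, \<dots>, C ! (2 * n)\<close>.
  The entries of \<open>C\<close> are block labels in \<open>{1..m}\<close>, so label \<open>c\<close> denotes \<open>Es ! (c - 1)\<close>.
\<close>

definition two_sided_configurations ::
    "('a, 'c) monoid_scheme \<Rightarrow> 'a list \<Rightarrow> 'a set list \<Rightarrow> nat list set" where
  "two_sided_configurations G gs Es =
     {C. length C = 2 * length gs + 1 \<and> set C \<subseteq> {1..length Es} \<and>
         (\<exists>x \<in> Es ! (C ! 0 - 1). \<forall>i \<in> {1..length gs}.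
            gs ! (i - 1) \<otimes>\<^bsub>G\<^esub> x \<in> Es ! (C ! i - 1) \<and>
            x \<otimes>\<^bsub>G\<^esub> gs ! (i - 1) \<in> Es ! (C ! (i + length gs) - 1))}"

definition Con_t :: "('a, 'c) monoid_scheme \<Rightarrow> nat list set set" where
  "Con_t G = {two_sided_configurations G gs Es | gs Es. configuration_pair G gs Es}"

definition finite_index_normal_subgroups :: "('a, 'c) monoid_scheme \<Rightarrow> 'a set set" where
  "finite_index_normal_subgroups G = {N. N \<lhd> G \<and> finite (rcosets\<^bsub>G\<^esub> N)}"

text \<open>Finiteness is required separately because \<^const>\<open>card\<close> is 0 on infinite sets.\<close>

definition normal_subgroups_of_index :: "('a, 'c) monoid_scheme \<Rightarrow> nat \<Rightarrow> 'a set set" where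
  "normal_subgroups_of_index G n =
     {N. N \<lhd> G \<and> finite (rcosets\<^bsub>G\<^esub> N) \<and> card (rcosets\<^bsub>G\<^esub> N) = n}"

end

theory Submission
  imports Defs
begin

text \<open>
  Partition \<open>G\<close> into the fibres of an epimorphism onto a finite group \<open>Q\<close>. A configuration pair of
  \<open>H\<close> with the same configurations labels the elements of \<open>H\<close> by a map \<open>p\<close> to \<open>Q\<close> under
  which left translation by each generator of \<open>H\<close> becomes left multiplication by the image in \<open>Q\<close>
  of the corresponding generator of \<open>G\<close>. Hence \<open>h \<mapsto> p(h) p(1)\<^sup>-\<^sup>1\<close> is an epimorphism from \<open>H\<close> to
  \<open>Q\<close>: finite quotients transfer. For multiplicities, \<open>G\<close> has only finitely many normal subgroups
  with quotient \<open>Q\<close>; applying the transfer to the quotient by their intersection embeds them into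
  the normal subgroups of \<open>H\<close> with quotient \<open>Q\<close>, and by symmetry there are equally many.
\<close>

section \<open>Epimorphisms, quotients and kernels\<close>

text \<open>On \<open>A\<close> the map \<open>g\<close> factors through \<open>f\<close>. This
  serves to bound kernels by values on generators, and cosets by pairs of cosets.\<close>

lemma finite_image_factor:
  assumes "finite (f ` A)" and "\<And>x y. \<lbrakk>x \<in> A; y \<in> A; f x = f y\<rbrakk> \<Longrightarrow> g x = g y"
  shows "finite (g ` A)"
proof -
  have "g x = g (inv_into A f (f x))" if "x \<in> A" for x
    using that by (intro assms(2)) (auto simp: inv_into_into f_inv_into_f)
  then have "g ` A \<subseteq> (\<lambda>v. g (inv_into A f v)) ` f ` A"
    by blast
  then show ?thesis
    using assms(1) finite_subset by blast
qed

lemma hom_eq_on_generate: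
  assumes "group G" "group Q" "f \<in> hom G Q" "g \<in> hom G Q" "S \<subseteq> carrier G"
    and eq: "\<And>s. s \<in> S \<Longrightarrow> f s = g s" and "x \<in> generate G S"
  shows "f x = g x"
proof -
  interpret f: group_hom G Q f
    using assms by (simp add: group_hom_def group_hom_axioms_def)
  interpret g: group_hom G Q g
    using assms by (simp add: group_hom_def group_hom_axioms_def)
  show ?thesis
    using \<open>x \<in> generate G S\<close>
  proof induction
    case one
    then show ?case by simp
  next
    case (incl h)
    then show ?case by (rule eq)
  next
    case (inv h)
    then show ?case using assms(5) eq by (metis f.hom_inv g.hom_inv subsetD)
  next
    case (eng h1 h2)
    then show ?case
      using f.G.generate_in_carrier[OF assms(5)] by simp
  qed
qed

text \<open>The composite of \<open>f\<close> with the projection to \<open>Q Mod L\<close> is onto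
  and has the preimage of \<open>L\<close> as kernel. Kernels are normal, and the first isomorphism
  theorem gives the quotient.\<close>

lemma epi_vimage_normal:
  assumes "group G" "group Q" "f \<in> epi G Q" "L \<lhd> Q"
  shows "{x \<in> carrier G. f x \<in> L} \<lhd> G"
    and "G Mod {x \<in> carrier G. f x \<in> L} \<cong> Q Mod L"
proof -
  interpret L: normal L Q by fact
  let ?h = "\<lambda>x. L #>\<^bsub>Q\<^esub> f x"
  have f: "f \<in> hom G Q" "f ` carrier G = carrier Q"
    using assms(3) by (auto simp: epi_def)
  have "?h \<in> hom G (Q Mod L)"
    using hom_compose[OF f(1) L.r_coset_hom_Mod] by (simp add: comp_def)
  then interpret h: group_hom G "Q Mod L" ?h
    using assms(1) L.factorgroup_is_group by (simp add: group_hom_def group_hom_axioms_def)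
  have "f x \<in> carrier Q" if "x \<in> carrier G" for x
    using that f(2) by blast
  then have ker: "kernel G (Q Mod L) ?h = {x \<in> carrier G. f x \<in> L}"
    using L.subgroup_axioms \<open>group Q\<close>
    by (auto simp: kernel_def group.coset_join2 intro: group.coset_join1 L.rcos_const)
  show "{x \<in> carrier G. f x \<in> L} \<lhd> G"
    using h.normal_kernel ker by simp
  have "?h ` carrier G = carrier (Q Mod L)"
    unfolding carrier_FactGroup f(2)[symmetric] by auto
  then show "G Mod {x \<in> carrier G. f x \<in> L} \<cong> Q Mod L"
    using h.FactGroup_iso ker by simp
qed

lemma coset_map_epi:
  assumes "N \<lhd> G"
  shows "(\<lambda>x. N #>\<^bsub>G\<^esub> x) \<in> epi G (G Mod N)"
  using normal.r_coset_hom_Mod[OF assms] by (auto simp: epi_def carrier_FactGroup)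

text \<open>The projection followed by an isomorphism to \<open>Q\<close> still has kernel
  \<open>N\<close>. This turns counting normal subgroups into counting homomorphisms.\<close>

lemma normal_quotient_iso_imp_kernel:
  assumes "N \<lhd> G" "group Q" "G Mod N \<cong> Q"
  obtains f where "f \<in> hom G Q" "N = kernel G Q f"
proof -
  interpret N: normal N G by fact
  interpret GN: group "G Mod N" by (rule N.factorgroup_is_group)
  obtain i where i: "i \<in> iso (G Mod N) Q"
    using assms(3) by (auto simp: is_iso_def)
  then interpret i: group_hom "G Mod N" Q i
    using assms(2) by (simp add: group_hom_def group_hom_axioms_def iso_def GN.is_group)
  let ?f = "\<lambda>x. i (N #>\<^bsub>G\<^esub> x)"
  have hom: "?f \<in> hom G Q"
    using hom_compose[OF N.r_coset_hom_Mod i.homh] by (simp add: comp_def)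
  have "?f x = \<one>\<^bsub>Q\<^esub> \<longleftrightarrow> x \<in> N" if x: "x \<in> carrier G" for x
  proof -
    have "N #>\<^bsub>G\<^esub> x \<in> carrier (G Mod N)" "N \<in> carrier (G Mod N)"
      using x GN.one_closed by (auto simp: carrier_FactGroup)
    moreover have "i N = \<one>\<^bsub>Q\<^esub>"
      using i.hom_one by simp
    moreover have "inj_on i (carrier (G Mod N))"
      using i by (simp add: iso_def bij_betw_def)
    ultimately have "?f x = \<one>\<^bsub>Q\<^esub> \<longleftrightarrow> N #>\<^bsub>G\<^esub> x = N"
      by (metis inj_onD)
    then show ?thesis
      using x N.subgroup_axioms N.is_group by (metis N.coset_join1 N.coset_join2 N.subset)
  qed
  then have "N = kernel G Q ?f"
    using N.subset by (auto simp: kernel_def)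
  with hom show ?thesis by (rule that)
qed

section \<open>Finiteness and intersections of normal subgroups of finite index\<close>

text \<open>A homomorphism to \<open>Q\<close> is fixed by its values on a finite generating set, so
  only finitely many kernels occur.\<close>

lemma finite_normal_subgroups_with_quotient:
  assumes "finitely_generated_group G" "group Q" "finite (carrier Q)"
  shows "finite {N. N \<lhd> G \<and> G Mod N \<cong> Q}"
proof -
  obtain S where S: "finite S" "S \<subseteq> carrier G" "generate G S = carrier G" and G: "group G"
    using assms(1) by (auto simp: finitely_generated_group_def)
  have "(\<lambda>f. restrict f S) ` hom G Q \<subseteq> PiE S (\<lambda>_. carrier Q)"
    using S(2) by (auto simp: hom_def)
  then have "finite ((\<lambda>f. restrict f S) ` hom G Q)"
    using S(1) assms(3) finite_PiE finite_subset by meson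
  moreover have "kernel G Q f = kernel G Q g"
    if "f \<in> hom G Q" "g \<in> hom G Q" "restrict f S = restrict g S" for f g
  proof -
    have "f s = g s" if "s \<in> S" for s
      using that \<open>restrict f S = restrict g S\<close> by (metis restrict_apply')
    then have "f x = g x" if "x \<in> carrier G" for x
      using hom_eq_on_generate[OF G assms(2) \<open>f \<in> hom G Q\<close> \<open>g \<in> hom G Q\<close> S(2)] that S(3) by simp
    then show ?thesis by (auto simp: kernel_def)
  qed
  ultimately have "finite (kernel G Q ` hom G Q)"
    by (rule finite_image_factor)
  moreover have "{N. N \<lhd> G \<and> G Mod N \<cong> Q} \<subseteq> kernel G Q ` hom G Q"
    using assms(2) by (auto elim!: normal_quotient_iso_imp_kernel)
  ultimately show ?thesis
    using finite_subset by blast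
qed

lemma finite_index_normal_subgroups_iff:
  "N \<in> finite_index_normal_subgroups G \<longleftrightarrow> N \<lhd> G \<and> finite (carrier (G Mod N))"
  by (simp add: finite_index_normal_subgroups_def FactGroup_def)

text \<open>The coset of \<open>x\<close> modulo \<open>N \<inter> K\<close> is determined by its
  cosets modulo \<open>N\<close> and modulo \<open>K\<close>, and there are finitely many such
  pairs.\<close>

lemma finite_index_normal_Int:
  assumes "N \<in> finite_index_normal_subgroups G" "K \<in> finite_index_normal_subgroups G"
  shows "N \<inter> K \<in> finite_index_normal_subgroups G"
proof -
  interpret N: normal N G
    using assms(1) by (simp add: finite_index_normal_subgroups_def)
  interpret K: normal K G
    using assms(2) by (simp add: finite_index_normal_subgroups_def)
  have NK: "N \<inter> K \<lhd> G"
    by (rule N.normal_subgroup_intersect[OF N.normal_axioms K.normal_axioms])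
  let ?f = "\<lambda>x. (N #>\<^bsub>G\<^esub> x, K #>\<^bsub>G\<^esub> x)"
  have "?f ` carrier G \<subseteq> carrier (G Mod N) \<times> carrier (G Mod K)"
    by (auto simp: carrier_FactGroup)
  then have "finite (?f ` carrier G)"
    using assms finite_subset unfolding finite_index_normal_subgroups_iff by blast
  moreover have "N \<inter> K #>\<^bsub>G\<^esub> x = N \<inter> K #>\<^bsub>G\<^esub> y"
    if xy: "x \<in> carrier G" "y \<in> carrier G" "?f x = ?f y" for x y
  proof -
    have "x \<in> N #>\<^bsub>G\<^esub> y" "x \<in> K #>\<^bsub>G\<^esub> y"
      using xy N.rcos_self[OF xy(1) N.subgroup_axioms] N.rcos_self[OF xy(1) K.subgroup_axioms] by auto
    then obtain a b where ab: "a \<in> N" "x = a \<otimes>\<^bsub>G\<^esub> y" "b \<in> K" "x = b \<otimes>\<^bsub>G\<^esub> y"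
      by (auto simp: r_coset_def)
    then have "a = b"
      using xy(2) by (metis N.mem_carrier K.mem_carrier N.right_cancel)
    then have "x \<in> N \<inter> K #>\<^bsub>G\<^esub> y"
      using ab by (auto simp: r_coset_def)
    then show ?thesis
      using N.repr_independence[OF _ xy(2) normal_imp_subgroup[OF NK]] by simp
  qed
  ultimately have "finite ((\<lambda>x. N \<inter> K #>\<^bsub>G\<^esub> x) ` carrier G)"
    by (rule finite_image_factor)
  with NK show ?thesis
    by (simp add: finite_index_normal_subgroups_iff carrier_FactGroup)
qed

lemma finite_index_normal_Inter:
  assumes "finite S" "S \<noteq> {}" "S \<subseteq> finite_index_normal_subgroups G"
  shows "\<Inter> S \<in> finite_index_normal_subgroups G"
  using assms by (induction rule: finite_ne_induct) (auto intro: finite_index_normal_Int)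

section \<open>Transfer of finite quotients through configurations\<close>

text \<open>The witness is \<open>y\<close> itself: the list reads off the labels of
  \<open>y\<close>, its left translates and its right translates. \<open>Suc\<close> appears because
  \<open>lab\<close> indexes \<open>Fs\<close> from 0, while configurations label blocks from
  1.\<close>

lemma configuration_of_element:
  assumes pair: "configuration_pair H hs Fs" and "group H" and y: "y \<in> carrier H"
    and lab: "\<And>z. z \<in> carrier H \<Longrightarrow> lab z < length Fs \<and> z \<in> Fs ! lab z"
  shows "map (Suc \<circ> lab) (y # map (\<lambda>h. h \<otimes>\<^bsub>H\<^esub> y) hs @ map (\<lambda>h. y \<otimes>\<^bsub>H\<^esub> h) hs)
           \<in> two_sided_configurations H hs Fs"
proof -
  interpret H: group H by fact
  have hs: "h \<in> carrier H" if "h \<in> set hs" for h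
    using pair that by (auto simp: configuration_pair_def generating_tuple_def)
  show ?thesis
    unfolding two_sided_configurations_def
    using y hs lab by (auto simp: nth_append nth_Cons' Suc_le_eq intro!: bexI[of _ y])
qed

lemma epi_transfer:
  assumes fg: "finitely_generated_group G" and "group H" and sub: "Con_t G \<subseteq> Con_t H"
    and "group Q" and fin: "finite (carrier Q)" and "f \<in> epi G Q"
  shows "\<exists>t. t \<in> epi H Q"
proof -
  obtain S where "finite S" "S \<subseteq> carrier G" "generate G S = carrier G" and G: "group G"
    using fg by (auto simp: finitely_generated_group_def)
  then obtain gs where gs: "generating_tuple G gs"
    using finite_list by (metis generating_tuple_def)
  interpret H: group H by fact
  interpret Q: group Q by fact
  have f: "f \<in> hom G Q" "f ` carrier G = carrier Q"
    using \<open>f \<in> epi G Q\<close> by (auto simp: epi_def)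
  interpret f: group_hom G Q f
    using G f(1) by (simp add: group_hom_def group_hom_axioms_def Q.is_group)
  obtain qs where qs: "set qs = carrier Q" "distinct qs"
    using finite_distinct_list[OF fin] by blast
  \<comment> \<open>Entry \<open>i\<close> of \<open>Es\<close> is the fibre over
    \<open>qs ! i\<close>, so block labels encode elements of \<open>Q\<close>.\<close>
  define Es where "Es = map (\<lambda>q. {x \<in> carrier G. f x = q}) qs"
  have pairG: "configuration_pair G gs Es"
    unfolding configuration_pair_def
  proof (intro conjI)
    \<comment> \<open>Surjectivity of \<open>f\<close> makes every fibre nonempty, which is used
      both for distinctness of the blocks and for the partition property.\<close>
    have ne: "\<exists>x \<in> carrier G. f x = q" if "q \<in> carrier Q" for q
      using that f(2) by (metis imageE)
    then have "inj_on (\<lambda>q. {x \<in> carrier G. f x = q}) (carrier Q)"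
      by (intro inj_onI) blast
    then show "distinct Es"
      using qs by (simp add: Es_def distinct_map)
    show "partition_on (carrier G) (set Es)"
      using ne by (auto simp: partition_on_def Es_def qs disjoint_def)
  qed (rule gs)
  then have "two_sided_configurations G gs Es \<in> Con_t H"
    using sub by (auto simp: Con_t_def)
  then obtain hs Fs where pairH: "configuration_pair H hs Fs"
    and eq: "two_sided_configurations G gs Es = two_sided_configurations H hs Fs"
    by (auto simp: Con_t_def)
  have hs: "set hs \<subseteq> carrier H" "generate H (set hs) = carrier H"
    using pairH by (auto simp: configuration_pair_def generating_tuple_def)
  have "\<exists>j. j < length Fs \<and> z \<in> Fs ! j" if "z \<in> carrier H" for z
    using pairH that by (metis UnionE configuration_pair_def in_set_conv_nth partition_onD1)
  then obtain lab where lab: "\<And>z. z \<in> carrier H \<Longrightarrow> lab z < length Fs \<and> z \<in> Fs ! lab z"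
    by metis
  \<comment> \<open>\<open>lab z\<close> is an index into \<open>Fs\<close>; reading it as an index
    into \<open>qs\<close> turns blocks of \<open>H\<close> into elements of \<open>Q\<close>. The
    bound \<open>lab z < length qs\<close> follows from \<open>conf\<close>.\<close>
  define p where "p z = qs ! lab z" for z
  \<comment> \<open>The configuration of \<open>y\<close> in \<open>H\<close> is also one of
    \<open>G\<close>, so some \<open>x\<close> in \<open>G\<close> carries the same labels as
    \<open>y\<close>, and its translates by \<open>gs ! i\<close> the same labels as those of
    \<open>y\<close> by \<open>hs ! i\<close>. The bounds keep lookups in \<open>qs\<close> and
    \<open>Es\<close> within range.\<close>
  have conf: "length hs = length gs \<and> lab y < length qs \<and>
      (\<exists>x \<in> Es ! lab y. \<forall>i < length gs. lab (hs ! i \<otimes>\<^bsub>H\<^esub> y) < length qs \<and>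
         gs ! i \<otimes>\<^bsub>G\<^esub> x \<in> Es ! lab (hs ! i \<otimes>\<^bsub>H\<^esub> y))"
    if y: "y \<in> carrier H" for y
  proof -
    let ?C = "map (Suc \<circ> lab) (y # map (\<lambda>h. h \<otimes>\<^bsub>H\<^esub> y) hs @ map (\<lambda>h. y \<otimes>\<^bsub>H\<^esub> h) hs)"
    have "?C \<in> two_sided_configurations G gs Es"
      unfolding eq by (rule configuration_of_element[OF pairH \<open>group H\<close> y lab])
    then have len: "length ?C = 2 * length gs + 1" and lb: "set ?C \<subseteq> {1..length Es}"
      and "\<exists>x \<in> Es ! (?C ! 0 - 1). \<forall>i \<in> {1..length gs}. gs ! (i - 1) \<otimes>\<^bsub>G\<^esub> x \<in> Es ! (?C ! i - 1)"
      unfolding two_sided_configurations_def by blast+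
    then obtain x where x: "x \<in> Es ! (?C ! 0 - 1)"
        "\<And>i. i \<in> {1..length gs} \<Longrightarrow> gs ! (i - 1) \<otimes>\<^bsub>G\<^esub> x \<in> Es ! (?C ! i - 1)"
      by blast
    have l: "length hs = length gs"
      using len by simp
    have "gs ! i \<otimes>\<^bsub>G\<^esub> x \<in> Es ! lab (hs ! i \<otimes>\<^bsub>H\<^esub> y)" if "i < length gs" for i
      using x(2)[of "Suc i"] that l by (simp add: nth_append)
    moreover have "lab (hs ! i \<otimes>\<^bsub>H\<^esub> y) < length qs" if "i < length gs" for i
    proof -
      have "Suc (lab (hs ! i \<otimes>\<^bsub>H\<^esub> y)) \<in> set ?C"
        using that l by auto
      then show ?thesis
        using lb by (force simp: Es_def)
    qed
    ultimately show ?thesis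
      using l lb x(1) by (auto simp: Es_def)
  qed
  have gs_closed: "gs ! i \<in> carrier G" if "i < length gs" for i
    using gs that by (auto simp: generating_tuple_def)
  have len: "length hs = length gs"
    using conf[OF H.one_closed] by simp
  have p_closed: "p y \<in> carrier Q" if "y \<in> carrier H" for y
    using conf[OF that] qs(1) by (metis p_def nth_mem)
  \<comment> \<open>Shared labels mean \<open>f x = p y\<close>, and \<open>f\<close> is
    multiplicative on the translate of the witness \<open>x\<close>.\<close>
  have p_gen: "p (hs ! i \<otimes>\<^bsub>H\<^esub> y) = f (gs ! i) \<otimes>\<^bsub>Q\<^esub> p y"
    if y: "y \<in> carrier H" and i: "i < length gs" for y i
  proof -
    obtain x where x: "x \<in> Es ! lab y" "lab (hs ! i \<otimes>\<^bsub>H\<^esub> y) < length qs"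
        "gs ! i \<otimes>\<^bsub>G\<^esub> x \<in> Es ! lab (hs ! i \<otimes>\<^bsub>H\<^esub> y)" "lab y < length qs"
      using conf[OF y] i by blast
    then have "x \<in> carrier G" "f x = p y" "f (gs ! i \<otimes>\<^bsub>G\<^esub> x) = p (hs ! i \<otimes>\<^bsub>H\<^esub> y)"
      by (auto simp: Es_def p_def)
    then show ?thesis
      using gs_closed[OF i] by (metis f.hom_mult)
  qed
  \<comment> \<open>The multiplier \<open>a\<close> must not depend on \<open>z\<close>. Elements
    admitting such an \<open>a\<close> are closed under products and inverses, so the generators
    suffice.\<close>
  have trans: "\<exists>a \<in> carrier Q. \<forall>z \<in> carrier H. p (h \<otimes>\<^bsub>H\<^esub> z) = a \<otimes>\<^bsub>Q\<^esub> p z"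
    if "h \<in> generate H (set hs)" for h
    using that
  proof induction
    case one
    show ?case
      using p_closed by (intro bexI[of _ "\<one>\<^bsub>Q\<^esub>"]) auto
  next
    case (incl h)
    then obtain i where i: "i < length gs" "h = hs ! i"
      using len by (metis in_set_conv_nth)
    then show ?case
      using p_gen gs_closed f.hom_closed by blast
  next
    case (inv h)
    then obtain i where i: "i < length gs" "h = hs ! i"
      using len by (metis in_set_conv_nth)
    have a: "f (gs ! i) \<in> carrier Q" and h: "h \<in> carrier H"
      using gs_closed[OF i(1)] hs(1) inv by auto
    have "p (inv\<^bsub>H\<^esub> h \<otimes>\<^bsub>H\<^esub> z) = inv\<^bsub>Q\<^esub> f (gs ! i) \<otimes>\<^bsub>Q\<^esub> p z" if z: "z \<in> carrier H" for z
    proof -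
      have w: "inv\<^bsub>H\<^esub> h \<otimes>\<^bsub>H\<^esub> z \<in> carrier H"
        using h z by simp
      have "h \<otimes>\<^bsub>H\<^esub> (inv\<^bsub>H\<^esub> h \<otimes>\<^bsub>H\<^esub> z) = z"
        using h z by (simp add: H.m_assoc[symmetric])
      then have "p z = f (gs ! i) \<otimes>\<^bsub>Q\<^esub> p (inv\<^bsub>H\<^esub> h \<otimes>\<^bsub>H\<^esub> z)"
        using p_gen[OF w i(1)] i(2) by simp
      then show ?thesis
        using a p_closed[OF w] by (simp add: Q.m_assoc[symmetric])
    qed
    then show ?case
      using a by blast
  next
    case (eng h k)
    then obtain a b where ab: "a \<in> carrier Q" "\<forall>z \<in> carrier H. p (h \<otimes>\<^bsub>H\<^esub> z) = a \<otimes>\<^bsub>Q\<^esub> p z"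
        "b \<in> carrier Q" "\<forall>z \<in> carrier H. p (k \<otimes>\<^bsub>H\<^esub> z) = b \<otimes>\<^bsub>Q\<^esub> p z"
      by blast
    have hk: "h \<in> carrier H" "k \<in> carrier H"
      using eng hs(2) by auto
    have "p (h \<otimes>\<^bsub>H\<^esub> k \<otimes>\<^bsub>H\<^esub> z) = a \<otimes>\<^bsub>Q\<^esub> b \<otimes>\<^bsub>Q\<^esub> p z" if "z \<in> carrier H" for z
      using that hk ab p_closed by (simp add: H.m_assoc Q.m_assoc)
    then show ?case
      using ab by blast
  qed
  \<comment> \<open>\<open>p\<close> need not send the identity to the identity. Right division by
    its value there makes \<open>t h\<close> the multiplier of translation by
    \<open>h\<close>.\<close>
  define t where "t h = p h \<otimes>\<^bsub>Q\<^esub> inv\<^bsub>Q\<^esub> p \<one>\<^bsub>H\<^esub>" for h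
  have t_closed: "t h \<in> carrier Q" if "h \<in> carrier H" for h
    using that p_closed by (simp add: t_def)
  have pt: "p (h \<otimes>\<^bsub>H\<^esub> z) = t h \<otimes>\<^bsub>Q\<^esub> p z" if h: "h \<in> carrier H" and z: "z \<in> carrier H" for h z
  proof -
    obtain a where a: "a \<in> carrier Q" "\<forall>z \<in> carrier H. p (h \<otimes>\<^bsub>H\<^esub> z) = a \<otimes>\<^bsub>Q\<^esub> p z"
      using trans h hs(2) by blast
    then have "p h = a \<otimes>\<^bsub>Q\<^esub> p \<one>\<^bsub>H\<^esub>"
      using h by (metis H.one_closed H.r_one)
    then have "t h = a"
      using a(1) p_closed[OF H.one_closed] by (simp add: t_def Q.m_assoc)
    then show ?thesis
      using a z by simp
  qed
  have "t \<in> hom H Q"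
  proof (rule homI)
    fix h k assume "h \<in> carrier H" "k \<in> carrier H"
    then show "t (h \<otimes>\<^bsub>H\<^esub> k) = t h \<otimes>\<^bsub>Q\<^esub> t k"
      using pt[of h k] p_closed t_closed by (simp add: t_def[of "h \<otimes>\<^bsub>H\<^esub> k"] t_def[of k] Q.m_assoc)
  qed (rule t_closed)
  then interpret t: group_hom H Q t
    by (simp add: group_hom_def group_hom_axioms_def H.is_group Q.is_group)
  have "t (hs ! i) = f (gs ! i)" if i: "i < length gs" for i
  proof -
    have c: "hs ! i \<in> carrier H" "f (gs ! i) \<in> carrier Q"
      using i len hs(1) gs_closed by auto
    then have "t (hs ! i) \<otimes>\<^bsub>Q\<^esub> p \<one>\<^bsub>H\<^esub> = f (gs ! i) \<otimes>\<^bsub>Q\<^esub> p \<one>\<^bsub>H\<^esub>"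
      using p_gen[OF H.one_closed i] pt[OF c(1) H.one_closed] by simp
    then show ?thesis
      using c p_closed t_closed by simp
  qed
  \<comment> \<open>Corresponding generators have equal images, so \<open>t\<close> and
    \<open>f\<close> have the same image, namely all of \<open>Q\<close>.\<close>
  then have "map t hs = map f gs"
    using len by (simp add: list_eq_iff_nth_eq)
  then have "t ` set hs = f ` set gs"
    by (metis set_map)
  then have "t ` carrier H = carrier Q"
    using t.generate_img[of "set hs"] f.generate_img[of "set gs"] hs gs f(2)
    by (simp add: generating_tuple_def)
  with \<open>t \<in> hom H Q\<close> have "t \<in> epi H Q"
    by (simp add: epi_def)
  then show ?thesis by (rule exI[of _ t])
qed

text \<open>The subgroup \<open>M\<close> is the kernel of an epimorphism from \<open>H\<close> onto
  \<open>G Mod N\<close> supplied by \<open>epi_transfer\<close>.\<close>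

lemma quotient_transfer:
  assumes "finitely_generated_group G" "group H" "Con_t G \<subseteq> Con_t H"
    and N: "N \<in> finite_index_normal_subgroups G"
  shows "\<exists>M \<in> finite_index_normal_subgroups H. H Mod M \<cong> G Mod N"
proof -
  interpret N: normal N G
    using N by (simp add: finite_index_normal_subgroups_iff)
  obtain t where "t \<in> epi H (G Mod N)"
    using epi_transfer[OF assms(1-3) N.factorgroup_is_group _ coset_map_epi[OF N.normal_axioms]] N
    by (auto simp: finite_index_normal_subgroups_iff)
  then have t: "t \<in> hom H (G Mod N)" "t ` carrier H = carrier (G Mod N)"
    by (auto simp: epi_def)
  then interpret t: group_hom H "G Mod N" t
    using assms(2) N.factorgroup_is_group by (simp add: group_hom_def group_hom_axioms_def)
  have "H Mod kernel H (G Mod N) t \<cong> G Mod N"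
    using t.FactGroup_iso t(2) by blast
  then show ?thesis
    using N t.normal_kernel iso_finite[OF \<open>H Mod kernel H (G Mod N) t \<cong> G Mod N\<close>]
    by (intro bexI) (simp_all add: finite_index_normal_subgroups_iff)
qed

section \<open>Counting normal subgroups with a given quotient\<close>

text \<open>All the \<open>N\<close> in question contain their intersection \<open>K\<close>, which
  has finite index because the family is finite. \<open>H\<close> also maps onto
  \<open>G Mod K\<close>, and pulling back along that map is injective by the correspondence
  theorem.\<close>

lemma lepoll_normal_subgroups_with_quotient:
  fixes G :: "('a, 'c) monoid_scheme" and H :: "('b, 'd) monoid_scheme"
  assumes fg: "finitely_generated_group G" and "group H" and sub: "Con_t G \<subseteq> Con_t H"
    and "group Q" "finite (carrier Q)"
  shows "lepoll {N. N \<lhd> G \<and> G Mod N \<cong> Q} {M. M \<lhd> H \<and> H Mod M \<cong> Q}" (is "lepoll ?A ?B")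
\<comment> \<open>The intersection of the empty family is \<open>UNIV\<close>, which need not lie in
  the carrier of \<open>G\<close>, so this case is split off.\<close>
proof (cases "?A = {}")
  case True
  then show ?thesis by (simp only: empty_lepoll)
next
  case False
  have G: "group G"
    using fg by (simp add: finitely_generated_group_def)
  define K where "K = \<Inter> ?A"
  have "?A \<subseteq> finite_index_normal_subgroups G"
    using \<open>finite (carrier Q)\<close>
    by (simp add: subset_iff finite_index_normal_subgroups_iff) (metis iso_finite)
  then have "K \<in> finite_index_normal_subgroups G"
    unfolding K_def using False finite_normal_subgroups_with_quotient[OF fg assms(4,5)]
    by (intro finite_index_normal_Inter)
  then have K: "K \<lhd> G" and finK: "finite (carrier (G Mod K))"
    by (auto simp: finite_index_normal_subgroups_iff)
  interpret K: normal K G by fact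
  have GK: "group (G Mod K)"
    by (rule K.factorgroup_is_group)
  let ?f = "\<lambda>x. K #>\<^bsub>G\<^esub> x"
  have fepi: "?f \<in> epi G (G Mod K)"
    by (rule coset_map_epi[OF K])
  then have f: "group_hom G (G Mod K) ?f" "?f ` carrier G = carrier (G Mod K)"
    using G GK by (auto simp: epi_def group_hom_def group_hom_axioms_def)
  obtain t where tepi: "t \<in> epi H (G Mod K)"
    using epi_transfer[OF fg \<open>group H\<close> sub GK finK fepi] by blast
  then have t: "t ` carrier H = carrier (G Mod K)"
    by (auto simp: epi_def)
  \<comment> \<open>Project \<open>N\<close> to \<open>G Mod K\<close>, then take the preimage under
    \<open>t\<close>.\<close>
  define m where "m N = {y \<in> carrier H. t y \<in> ?f ` N}" for N
  \<comment> \<open>Since \<open>K \<subseteq> N\<close>, the subgroup \<open>N\<close> is a union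
    of fibres of \<open>?f\<close>, so it can be recovered from its image in
    \<open>G Mod K\<close>.\<close>
  have vimage_image: "N = {x \<in> carrier G. ?f x \<in> ?f ` N}" if "N \<in> ?A" for N
  proof -
    interpret N: normal N G using that by simp
    have "K \<subseteq> N"
      using that by (auto simp: K_def)
    have "x \<in> N" if x: "x \<in> carrier G" and n: "n \<in> N" "?f x = ?f n" for x n
    proof -
      have "x \<in> ?f n"
        using x n K.rcos_self K.subgroup_axioms by blast
      then show ?thesis
        using \<open>K \<subseteq> N\<close> n(1) by (auto simp: r_coset_def)
    qed
    then show ?thesis
      using N.subset by auto
  qed
  have "m N \<in> ?B" if N: "N \<in> ?A" for N
  proof -
    have L: "?f ` N \<lhd> G Mod K"
      using N normal.surj_hom_normal_subgroup[OF _ f] by simp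
    have "H Mod m N \<cong> G Mod K Mod ?f ` N"
      unfolding m_def by (rule epi_vimage_normal[OF \<open>group H\<close> GK tepi L])
    \<comment> \<open>This is \<open>epi_vimage_normal\<close> for the projection, read backwards;
      by \<open>vimage_image\<close> the preimage there is \<open>N\<close> itself.\<close>
    also have "G Mod K Mod ?f ` N \<cong> G Mod N"
      using epi_vimage_normal(2)[OF G GK fepi L] vimage_image[OF N] N
      by (metis (no_types, lifting) group.iso_sym mem_Collect_eq normal.factorgroup_is_group)
    also have "G Mod N \<cong> Q"
      using N by simp
    finally show ?thesis
      using epi_vimage_normal(1)[OF \<open>group H\<close> GK tepi L] by (simp add: m_def)
  qed
  moreover have "inj_on m ?A"
  proof (rule inj_onI)
    fix N N' assume N: "N \<in> ?A" "N' \<in> ?A" "m N = m N'"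
    \<comment> \<open>As \<open>t\<close> is onto, the image of a preimage is the original set; thus
      \<open>m N\<close> determines the image of \<open>N\<close> in \<open>G Mod K\<close>, and
      hence \<open>N\<close>.\<close>
    have "t ` m L = ?f ` L" if "L \<in> ?A" for L
    proof -
      have "?f ` L \<subseteq> t ` carrier H"
        using that unfolding t f(2)[symmetric]
        by (intro image_mono) (simp add: normal_imp_subgroup subgroup.subset)
      moreover have "t ` {y \<in> C. t y \<in> D} = D" if "D \<subseteq> t ` C" for C D
        using that by fastforce
      ultimately show ?thesis
        by (simp add: m_def)
    qed
    then have "?f ` N = ?f ` N'"
      using N by metis
    then show "N = N'"
      using vimage_image[OF N(1)] vimage_image[OF N(2)] by metis
  qed
  ultimately show ?thesis
    unfolding lepoll_def by blast
qed

section \<open>Gluing bijections and isomorphisms of products\<close>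

text \<open>Fibres over distinct labels are disjoint, so bijections chosen fibre by fibre
  glue.\<close>

lemma bij_betw_from_fibres:
  assumes "\<And>c. {x \<in> A. k x = c} \<approx> {y \<in> B. l y = c}"
  shows "\<exists>b. bij_betw b A B \<and> (\<forall>x \<in> A. l (b x) = k x)"
proof -
  have "\<exists>h. \<forall>c. bij_betw (h c) {x \<in> A. k x = c} {y \<in> B. l y = c}"
    using assms unfolding eqpoll_def by (intro choice allI)
  then obtain h where h: "\<And>c. bij_betw (h c) {x \<in> A. k x = c} {y \<in> B. l y = c}"
    by blast
  let ?b = "\<lambda>x. h (k x) x"
  have b: "?b x \<in> B \<and> l (?b x) = k x" if "x \<in> A" for x
    using bij_betwE[OF h[of "k x"]] that by blast
  have "inj_on ?b A"
  proof (rule inj_onI)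
    fix x y assume xy: "x \<in> A" "y \<in> A" "?b x = ?b y"
    then have "k x = k y"
      using b by metis
    then show "x = y"
      using xy bij_betw_imp_inj_on[OF h[of "k x"]] by (auto dest: inj_onD)
  qed
  moreover have "B \<subseteq> ?b ` A"
  proof
    fix y assume "y \<in> B"
    then obtain x where "x \<in> A" "k x = l y" "y = h (l y) x"
      using bij_betw_imp_surj_on[OF h[of "l y"]] by blast
    then show "y \<in> ?b ` A"
      by (intro image_eqI[of _ _ x]) auto
  qed
  ultimately have "bij_betw ?b A B"
    using b by (auto simp: bij_betw_def)
  then show ?thesis
    using b by blast
qed

lemma product_group_iso:
  assumes b: "bij_betw b I J" and iso: "\<And>i. i \<in> I \<Longrightarrow> U i \<cong> V (b i)"
  shows "product_group I U \<cong> product_group J V"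
proof -
  obtain h where h: "\<And>i. i \<in> I \<Longrightarrow> h i \<in> iso (U i) (V (b i))"
    using bchoice[of I "\<lambda>i h. h \<in> Group.iso (U i) (V (b i))"] iso unfolding is_iso_def by blast
  define c where "c = inv_into I b"
  have cI: "c j \<in> I" and bc: "b (c j) = j" if "j \<in> J" for j
    using b that unfolding c_def bij_betw_def by (auto simp: inv_into_into f_inv_into_f)
  have bJ: "b i \<in> J" and cb: "c (b i) = i" if "i \<in> I" for i
    using b that unfolding c_def bij_betw_def by auto
  have hc: "h (c j) \<in> iso (U (c j)) (V j)" if "j \<in> J" for j
    using h[OF cI[OF that]] bc[OF that] by simp
  have bij: "bij_betw (h (c j)) (carrier (U (c j))) (carrier (V j))" if "j \<in> J" for j
    using hc[OF that] by (simp add: iso_def)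
  \<comment> \<open>Coordinate \<open>j\<close> comes from coordinate \<open>c j\<close> of
    \<open>x\<close>, with \<open>c\<close> inverse to \<open>b\<close>. The function is restricted
    to \<open>J\<close> because elements of the product are extensional.\<close>
  define F where "F x = (\<lambda>j\<in>J. h (c j) (x (c j)))" for x
  have "F \<in> iso (product_group I U) (product_group J V)"
    unfolding iso_def
  proof (intro CollectI conjI)
    show "F \<in> hom (product_group I U) (product_group J V)"
    proof (rule homI)
      fix x assume "x \<in> carrier (product_group I U)"
      then show "F x \<in> carrier (product_group J V)"
        using cI bij_betwE[OF bij] by (auto simp: F_def PiE_iff)
    next
      fix x y assume "x \<in> carrier (product_group I U)" "y \<in> carrier (product_group I U)"
      then show "F (x \<otimes>\<^bsub>product_group I U\<^esub> y) = F x \<otimes>\<^bsub>product_group J V\<^esub> F y"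
        using cI hc by (auto simp: F_def PiE_iff iso_def hom_def intro!: restrict_ext)
    qed
    show "bij_betw F (carrier (product_group I U)) (carrier (product_group J V))"
    proof (rule bij_betw_byWitness[where f' = "\<lambda>y. \<lambda>i\<in>I. inv_into (carrier (U i)) (h i) (y (b i))"])
      have bij': "bij_betw (h i) (carrier (U i)) (carrier (V (b i)))" if "i \<in> I" for i
        using h[OF that] by (simp add: iso_def)
      show "\<forall>x\<in>carrier (product_group I U).
          (\<lambda>i\<in>I. inv_into (carrier (U i)) (h i) (F x (b i))) = x"
        using bJ cb bij_betw_inv_into_left[OF bij']
        by (auto simp: F_def PiE_iff fun_eq_iff extensional_def)
      show "\<forall>y\<in>carrier (product_group J V).
          F (\<lambda>i\<in>I. inv_into (carrier (U i)) (h i) (y (b i))) = y"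
        using cI bc bij_betw_inv_into_right[OF bij]
        by (auto simp: F_def PiE_iff fun_eq_iff extensional_def)
      show "F ` carrier (product_group I U) \<subseteq> carrier (product_group J V)"
        using cI bij_betwE[OF bij] by (auto simp: F_def PiE_iff)
      show "(\<lambda>y. \<lambda>i\<in>I. inv_into (carrier (U i)) (h i) (y (b i))) ` carrier (product_group J V)
          \<subseteq> carrier (product_group I U)"
        using bJ bij_betwE[OF bij_betw_inv_into[OF bij']] by (auto simp: PiE_iff)
    qed
  qed
  then show ?thesis
    by (auto simp: is_iso_def)
qed

section \<open>Matching the normal subgroups of finite index\<close>

text \<open>The bijection is assembled over the isomorphism classes of finite quotients. Preserving
  quotients, it yields both the count by index and the isomorphism of products.\<close>

lemma normal_subgroup_matching:
  fixes G :: "('a, 'c) monoid_scheme" and H :: "('b, 'd) monoid_scheme"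
  assumes fgG: "finitely_generated_group G" and fgH: "finitely_generated_group H"
    and con: "Con_t G = Con_t H"
  shows "\<exists>b. bij_betw b (finite_index_normal_subgroups G) (finite_index_normal_subgroups H) \<and>
    (\<forall>N \<in> finite_index_normal_subgroups G. G Mod N \<cong> H Mod b N)"
proof -
  let ?A = "finite_index_normal_subgroups G" and ?B = "finite_index_normal_subgroups H"
  have G: "group G" and H: "group H"
    using fgG fgH by (auto simp: finitely_generated_group_def)
  have grpA: "group (G Mod N)" if "N \<in> ?A" for N
    using that by (simp add: finite_index_normal_subgroups_iff normal.factorgroup_is_group)
  have grpB: "group (H Mod M)" if "M \<in> ?B" for M
    using that by (simp add: finite_index_normal_subgroups_iff normal.factorgroup_is_group)
  \<comment> \<open>Isomorphism classes of quotients of \<open>G\<close> and of \<open>H\<close> live at different types; both are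
    encoded by the set of matching normal subgroups of \<open>H\<close>.\<close>
  define k where "k N = {M \<in> ?B. H Mod M \<cong> G Mod N}" for N
  define l where "l M = {M' \<in> ?B. H Mod M' \<cong> H Mod M}" for M
  have l_eq: "l M = l M' \<longleftrightarrow> H Mod M \<cong> H Mod M'" if "M \<in> ?B" "M' \<in> ?B" for M M'
  proof
    assume "l M = l M'"
    moreover have "M \<in> l M"
      using that by (simp add: l_def iso_refl)
    ultimately show "H Mod M \<cong> H Mod M'"
      by (simp add: l_def)
  next
    assume "H Mod M \<cong> H Mod M'"
    then show "l M = l M'"
      using group.iso_sym[OF grpB[OF that(1)]] by (auto simp: l_def intro: iso_trans)
  qed
  have k_eq: "k N = l M \<longleftrightarrow> G Mod N \<cong> H Mod M" if N: "N \<in> ?A" and M: "M \<in> ?B" for N M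
  proof
    assume "k N = l M"
    moreover have "M \<in> l M"
      using M by (simp add: l_def iso_refl)
    ultimately show "G Mod N \<cong> H Mod M"
      using group.iso_sym[OF grpB[OF M]] by (auto simp: k_def)
  next
    assume "G Mod N \<cong> H Mod M"
    then show "k N = l M"
      using group.iso_sym[OF grpA[OF N]] by (auto simp: k_def l_def intro: iso_trans)
  qed
  \<comment> \<open>The cases are whether \<open>c\<close> encodes the class of a finite quotient
    \<open>?Q\<close> of \<open>H\<close>. If it does, both fibres are the sets of all normal
    subgroups with quotient \<open>?Q\<close>; finite index is then automatic.\<close>
  have "{N \<in> ?A. k N = c} \<approx> {M \<in> ?B. l M = c}" for c
  proof (cases "\<exists>M0 \<in> ?B. l M0 = c")
    case True
    then obtain M0 where M0: "M0 \<in> ?B" "l M0 = c"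
      by blast
    let ?Q = "H Mod M0"
    have Q: "group ?Q" "finite (carrier ?Q)"
      using M0 grpB by (auto simp: finite_index_normal_subgroups_iff)
    have "{N \<in> ?A. k N = c} = {N. N \<lhd> G \<and> G Mod N \<cong> ?Q}"
      using k_eq M0 Q(2) iso_finite by (auto simp: finite_index_normal_subgroups_iff)
    moreover have "{M \<in> ?B. l M = c} = {M. M \<lhd> H \<and> H Mod M \<cong> ?Q}"
      using l_eq M0 Q(2) iso_finite by (auto simp: finite_index_normal_subgroups_iff)
    \<comment> \<open>Injections in both directions give equipollence by
      Schroeder-Bernstein.\<close>
    ultimately show ?thesis
      using lepoll_normal_subgroups_with_quotient[OF fgG H _ Q]
        lepoll_normal_subgroups_with_quotient[OF fgH G _ Q] con by (simp add: lepoll_antisym)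
  next
    case False
    \<comment> \<open>Every class arising from \<open>G\<close> also arises from \<open>H\<close>,
      so a value \<open>c\<close> missed by \<open>l\<close> has empty fibres on both sides.\<close>
    have "\<exists>M \<in> ?B. l M = k N" if N: "N \<in> ?A" for N
      using quotient_transfer[OF fgG H _ N] con k_eq[OF N] group.iso_sym[OF grpB]
      by (metis order_refl)
    then have "{N \<in> ?A. k N = c} = {}" "{M \<in> ?B. l M = c} = {}"
      using False by auto
    then show ?thesis by (simp only: eqpoll_refl eqpoll_empty_iff_empty)
  qed
  then obtain b where b: "bij_betw b ?A ?B" "\<forall>N \<in> ?A. l (b N) = k N"
    using bij_betw_from_fibres[of ?A k ?B l] by blast
  moreover have "G Mod N \<cong> H Mod b N" if "N \<in> ?A" for N
    using b that k_eq bij_betwE by metis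
  ultimately show ?thesis
    by blast
qed

theorem corollary3p7:
  fixes G :: "('a, 'c) monoid_scheme" and H :: "('b, 'd) monoid_scheme" and n :: nat
  assumes "finitely_generated_group G" and "finitely_generated_group H"
    and "Con_t G = Con_t H"
  shows "normal_subgroups_of_index G n \<approx> normal_subgroups_of_index H n \<and>
         product_group (finite_index_normal_subgroups G) (\<lambda>N. G Mod N)
           \<cong> product_group (finite_index_normal_subgroups H) (\<lambda>M. H Mod M)"
proof
  let ?A = "finite_index_normal_subgroups G" and ?B = "finite_index_normal_subgroups H"
  obtain b where b: "bij_betw b ?A ?B" "\<forall>N \<in> ?A. G Mod N \<cong> H Mod b N"
    using normal_subgroup_matching[OF assms] by blast
  show "product_group ?A (\<lambda>N. G Mod N) \<cong> product_group ?B (\<lambda>M. H Mod M)"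
    using product_group_iso[of b ?A ?B "\<lambda>N. G Mod N" "\<lambda>M. H Mod M"] b by simp
  \<comment> \<open>Isomorphic quotients have equal order, so \<open>b\<close> preserves the index
    and restricts to the subgroups of index \<open>n\<close>.\<close>
  have "card (rcosets\<^bsub>H\<^esub> b N) = card (rcosets\<^bsub>G\<^esub> N)" if "N \<in> ?A" for N
    using iso_same_card[of "G Mod N" "H Mod b N"] b(2) that by (simp add: FactGroup_def)
  moreover have "?B = b ` ?A"
    using b(1) by (simp add: bij_betw_def)
  ultimately have "b ` {N \<in> ?A. card (rcosets\<^bsub>G\<^esub> N) = n} = {M \<in> ?B. card (rcosets\<^bsub>H\<^esub> M) = n}"
    by auto
  then have "bij_betw b {N \<in> ?A. card (rcosets\<^bsub>G\<^esub> N) = n} {M \<in> ?B. card (rcosets\<^bsub>H\<^esub> M) = n}"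
    by (intro bij_betw_subset[OF b(1)]) auto
  moreover have "normal_subgroups_of_index G n = {N \<in> ?A. card (rcosets\<^bsub>G\<^esub> N) = n}"
    "normal_subgroups_of_index H n = {M \<in> ?B. card (rcosets\<^bsub>H\<^esub> M) = n}"
    by (auto simp: normal_subgroups_of_index_def finite_index_normal_subgroups_def)
  ultimately show "normal_subgroups_of_index G n \<approx> normal_subgroups_of_index H n"
    unfolding eqpoll_def by auto
qed

end
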